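(* Let $\mu$ be a probability distribution on $\mathbb{R}$ whose characteristic function $\psi(u)=\int e^{\mathrm{i}ux}\mu(dx)$ is $C^\infty$ and satisfies $$\int_{-\infty}^\infty|u|^m\big|\psi^{(r)}(u)\big|\,du<\infty\qquad\text{for all integers }r\ge0,\ m\ge0,$$ and let $p$ be the $C^\infty$ density of $\mu$. Then, for all integers $r\ge0$ and $m\ge0$ and all $x\ne0$, $$p^{(m)}(x)=\sum_{j=1}^{\min(r,m)}c_{r,j}^m\prod_{l=0}^{j-1}(m-l)\,\frac1{x^j}\,p^{(m-j)}(x)+(-1)^r\frac{(-\mathrm{i})^{m-r}}{2\pi x^r}\int e^{-\mathrm{i}ux}u^m\frac{d^r\psi(u)}{du^r}\,du,$$ where the coefficients $c_{r,j}^m$ are given by the recursion $$c_{r,0}^m=-1,\qquad c_{r,j}^m=0\ \ (j>r),\qquad c_{r+1,j}^m=c_{r,j}^m+c_{r,j-1}^{m-1}\ \ (j\ge1).$$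
   Context: Here $\mathrm{i}$ denotes the imaginary unit. The integrability condition guarantees that $\mu$ has a $C^\infty$ density $p$, with $p^{(m)}(x)=\frac{(-\mathrm{i})^m}{2\pi}\int e^{-\mathrm{i}ux}u^m\psi(u)\,du$. An empty sum equals $0$. *)

theory Defs
  imports "HOL-Probability.Probability"
begin

definition nth_deriv :: "nat \<Rightarrow> (real \<Rightarrow> 'a::real_normed_vector) \<Rightarrow> real \<Rightarrow> 'a" where
  "nth_deriv n f = ((\<lambda>g x. vector_derivative g (at x)) ^^ n) f"

lemma nth_deriv_0 [simp]: "nth_deriv 0 f = f"
  by (simp add: nth_deriv_def)

lemma nth_deriv_Suc: "nth_deriv (Suc n) f x = vector_derivative (nth_deriv n f) (at x)"
  by (simp add: nth_deriv_def)

(* vector_derivative is an arbitrary value where the derivative does not exist, so smoothness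
   demands differentiability at every order. *)
definition C_infinity :: "(real \<Rightarrow> 'a::real_normed_vector) \<Rightarrow> bool" where
  "C_infinity f \<longleftrightarrow> (\<forall>n x. nth_deriv n f differentiable (at x))"

(* tail_coeff r j m stands for c_{r,j}^m.  The upper index is an integer because the recursion
   lowers it without bound.  The equations below fix exactly the values prescribed by
   c_{r,0}^m = -1, c_{r,j}^m = 0 for j > r, and the recursion in r; see the lemmas that follow. *)
fun tail_coeff :: "nat \<Rightarrow> nat \<Rightarrow> int \<Rightarrow> int" where
  "tail_coeff r 0 m = -1"
| "tail_coeff 0 (Suc j) m = 0"
| "tail_coeff (Suc r) (Suc j) m = tail_coeff r (Suc j) m + tail_coeff r j (m - 1)"

lemma tail_coeff_eq_0: "r < j \<Longrightarrow> tail_coeff r j m = 0"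
  by (induction r j m rule: tail_coeff.induct) auto

lemma tail_coeff_rec:
  "1 \<le> j \<Longrightarrow> tail_coeff (r + 1) j m = tail_coeff r j m + tail_coeff r (j - 1) (m - 1)"
  by (cases j) auto

end

theory Submission
  imports Defs
begin

text \<open>
  Let \<open>A m r\<close> be the integral term of the expansion. Integrating by parts over the real line, with
  \<open>u\<^sup>m exp (- \<i> u x)\<close> as the factor to be differentiated, gives
  \<open>A m (r + 1) = A m r + (m / x) A (m - 1) r\<close>. Iterating this down to the terms \<open>A k 0\<close> reproduces
  the recursion for the coefficients, and \<open>A k 0\<close> is the \<open>k\<close>-th derivative of \<open>p\<close>. The latter
  follows by differentiating, first in the inversion formula for the distribution function and then
  \<open>k\<close> times in the resulting formula for \<open>p\<close>, under the integral sign.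
\<close>

text \<open>Dominated convergence is applied to the remainder of the linearisation at
  \<open>x\<close>. Since \<open>w\<close> bounds the derivative for every parameter, it also
  dominates that remainder.\<close>

lemma has_vector_derivative_lebesgue_integral:
  fixes f :: "real \<Rightarrow> 'b \<Rightarrow> 'a::{banach,second_countable_topology}"
  assumes int: "\<And>y. integrable M (f y)" and w: "integrable M w"
    and deriv: "\<And>y t. ((\<lambda>y. f y t) has_vector_derivative f' y t) (at y)"
    and bound: "\<And>y t. norm (f' y t) \<le> w t"
    and meas: "f' x \<in> borel_measurable M"
  shows "((\<lambda>y. \<integral>t. f y t \<partial>M) has_vector_derivative (\<integral>t. f' x t \<partial>M)) (at x)"
proof -
  have int': "integrable M (f' x)"
    using w meas by (rule Bochner_Integration.integrable_bound)
      (use bound in \<open>auto intro: order_trans[OF _ abs_ge_self]\<close>)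
  \<comment> \<open>The remainder divided by \<open>norm (y - x)\<close>. Integration commutes with
    forming it, so the claim amounts to the integral of \<open>R y\<close> tending to 0.\<close>
  define R where "R y t = (f y t - f x t - (y - x) *\<^sub>R f' x t) /\<^sub>R norm (y - x)" for y t
  have R_bound: "norm (R y t) \<le> 2 * w t" if "y \<noteq> x" for y t
  proof -
    \<comment> \<open>Mean value inequality: the remainder is controlled by the oscillation of
      \<open>f'\<close>, and two values bounded by \<open>w t\<close> differ by at most
      \<open>2 * w t\<close>.\<close>
    have "norm (f y t - f x t - (y - x) *\<^sub>R f' x t) \<le> norm (y - x) * (2 * w t)"
    proof (rule vector_differentiable_bound_linearization[where S=UNIV])
      show "norm (f' z t - f' x t) \<le> 2 * w t" for z
        using norm_triangle_ineq4[of "f' z t" "f' x t"] bound[of z t] bound[of x t] by linarith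
    qed (use deriv in auto)
    then show ?thesis
      using that by (simp only: R_def norm_scaleR) (simp add: divide_simps mult_ac)
  qed
  have R_int: "(\<integral>t. R y t \<partial>M) =
      ((\<integral>t. f y t \<partial>M) - (\<integral>t. f x t \<partial>M) - (y - x) *\<^sub>R (\<integral>t. f' x t \<partial>M)) /\<^sub>R norm (y - x)" for y
    unfolding R_def using int int' by simp
  have "((\<lambda>y. \<integral>t. R y t \<partial>M) \<longlongrightarrow> 0) (at x)"
    unfolding tendsto_at_iff_sequentially comp_def
  proof safe
    fix X :: "nat \<Rightarrow> real"
    assume X: "\<forall>i. X i \<in> UNIV - {x}" "X \<longlonglongrightarrow> x"
    have "(\<lambda>i. \<integral>t. R (X i) t \<partial>M) \<longlonglongrightarrow> (\<integral>t. 0 \<partial>M)"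
    proof (rule integral_dominated_convergence)
      show "integrable M (\<lambda>t. 2 * w t)" using w by simp
      show "R (X i) \<in> borel_measurable M" for i
        unfolding R_def using int meas by measurable
      show "AE t in M. norm (R (X i) t) \<le> 2 * w t" for i
        using R_bound X by auto
      have "((\<lambda>y. R y t) \<longlongrightarrow> 0) (at x)" for t
        using deriv[of t x] unfolding has_vector_derivative_def has_derivative_at_within R_def by simp
      then show "AE t in M. (\<lambda>i. R (X i) t) \<longlonglongrightarrow> 0"
        using X unfolding tendsto_at_iff_sequentially comp_def by auto
    qed simp
    then show "(\<lambda>i. \<integral>t. R (X i) t \<partial>M) \<longlonglongrightarrow> 0" by simp
  qed
  then show ?thesis
    unfolding has_vector_derivative_def has_derivative_at_within R_int
    by (simp add: bounded_linear_scaleR_left)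
qed

text \<open>This provides integration by parts over the line without boundary terms; integrability
  of \<open>F\<close> takes the place of decay at infinity.\<close>

lemma lborel_integral_derivative_eq_0:
  fixes F :: "real \<Rightarrow> 'a::euclidean_space"
  assumes deriv: "\<And>x. (F has_vector_derivative f x) (at x)"
    and cont: "continuous_on UNIV f"
    and F: "integrable lborel F" and f: "integrable lborel f"
  shows "(\<integral>x. f x \<partial>lborel) = 0"
proof (rule ccontr)
  let ?I = "\<integral>x. f x \<partial>lborel"
  assume nz: "?I \<noteq> 0"
  \<comment> \<open>\<open>F T - F (- T)\<close> is integrable in \<open>T\<close>, yet it tends to \<open>?I\<close>.\<close>
  have "((\<lambda>T. \<integral>x. indicator {-T..T} x *\<^sub>R f x \<partial>lborel) \<longlongrightarrow> ?I) at_top"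
  proof (rule integral_dominated_convergence_at_top[where w="\<lambda>x. norm (f x)"])
    show "AE x in lborel. ((\<lambda>T. indicator {-T..T} x *\<^sub>R f x) \<longlongrightarrow> f x) at_top"
    proof (rule AE_I2, rule tendsto_eventually)
      fix x :: real
      show "\<forall>\<^sub>F T in at_top. indicator {-T..T} x *\<^sub>R f x = f x"
        using eventually_ge_at_top[of "\<bar>x\<bar>"] by eventually_elim (auto simp: indicator_def)
    qed
  qed (use f in \<open>auto simp: indicator_def\<close>)
  moreover have "\<forall>\<^sub>F T in at_top. (\<integral>x. indicator {-T..T} x *\<^sub>R f x \<partial>lborel) = F T - F (- T)"
    using eventually_ge_at_top[of 0]
  proof eventually_elim
    fix T :: real assume "0 \<le> T"
    then show "(\<integral>x. indicator {-T..T} x *\<^sub>R f x \<partial>lborel) = F T - F (- T)"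
      by (intro integral_FTC_Icc)
        (auto intro: has_vector_derivative_at_within[OF deriv] continuous_on_subset[OF cont])
  qed
  ultimately have "((\<lambda>T. F T - F (- T)) \<longlongrightarrow> ?I) at_top"
    by (simp cong: tendsto_cong)
  then have "((\<lambda>T. norm (F T - F (- T))) \<longlongrightarrow> norm ?I) at_top"
    by (rule tendsto_norm)
  then have "\<forall>\<^sub>F T in at_top. norm ?I / 2 < norm (F T - F (- T))"
    by (rule order_tendstoD) (use nz in simp)
  then obtain T0 where T0: "\<And>T. T0 \<le> T \<Longrightarrow> norm ?I / 2 < norm (F T - F (- T))"
    unfolding eventually_at_top_linorder by blast
  have G: "integrable lborel (\<lambda>T. F T - F (- T))"
    using F lborel_integrable_real_affine[OF F, of "-1" 0] by simp
  \<comment> \<open>From \<open>T0\<close> on, an integrable function exceeds the positive constant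
    \<open>norm ?I / 2\<close>, which would force a half-line to have finite measure.\<close>
  have "integrable lborel (\<lambda>T::real. indicator {T0..} T *\<^sub>R (norm ?I / 2))"
    using G by (rule Bochner_Integration.integrable_bound)
      (use T0 in \<open>auto simp: indicator_def intro: less_imp_le\<close>)
  then have "integrable lborel (indicator {T0..} :: real \<Rightarrow> real)"
    using nz by (simp add: integrable_mult_left_iff flip: times_divide_eq_right)
  then have "emeasure lborel {T0..} < \<infinity>"
    by (simp add: integrable_indicator_iff)
  then obtain c where c: "0 \<le> c" "emeasure lborel {T0..} = ennreal c"
    by (cases "emeasure lborel {T0..}") auto
  \<comment> \<open>A subinterval longer than the supposed total length \<open>c\<close> gives the
    contradiction.\<close>
  have "emeasure lborel {T0..T0 + (c + 1)} \<le> emeasure lborel {T0..}"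
    by (rule emeasure_mono) auto
  with c show False
    by simp
qed

text \<open>The mass of \<open>{a<..y}\<close> is both a Levy inversion integral and the integral of
  \<open>p\<close>. Comparing the two derivatives at \<open>y = x\<close> gives the formula;
  continuity of \<open>p\<close> makes it hold at every point.\<close>

lemma (in real_distribution) density_inversion:
  fixes p :: "real \<Rightarrow> real"
  assumes p: "continuous_on UNIV p" "\<And>x. 0 \<le> p x" and M: "M = density lborel (\<lambda>x. ennreal (p x))"
    and psi: "integrable lborel (char M)"
  shows "complex_of_real (p x) = 1 / (2 * pi) * (CLINT t|lborel. iexp (-(t * x)) * char M t)"
proof -
  have p_meas [measurable]: "p \<in> borel_measurable borel"
    using p(1) by (rule borel_measurable_continuous_onI)
  \<comment> \<open>Any base point to the left of \<open>x\<close> would do: then all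
    \<open>y\<close> near \<open>x\<close> satisfy \<open>a < y\<close>.\<close>
  define a where "a = x - 1"
  \<comment> \<open>The Levy kernel, with derivative \<open>K'\<close> in \<open>y\<close>. At
    \<open>t = 0\<close> the kernel is constantly 0, so \<open>K'\<close> is set to 0 there as
    well.\<close>
  define K where "K y t = (if t = 0 then 0 else (iexp (-(t * a)) - iexp (-(t * y))) / (\<i> * t) * char M t)" for y t :: real
  define K' where "K' y t = (if t = 0 then 0 else iexp (-(t * y)) * char M t)" for y t :: real
  have K_bound: "cmod (K y t) \<le> \<bar>y - a\<bar> * cmod (char M t)" for y t
  proof (cases "t = 0")
    case False
    have "cmod ((iexp (-(t * a)) - iexp (-(t * y))) / (\<i> * t)) \<le> \<bar>y - a\<bar>"
      using Levy_Inversion_aux2[of "-y" "-a" t] Levy_Inversion_aux2[of "-a" "-y" t] False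
      by (cases "a \<le> y") (auto simp: norm_divide norm_minus_commute)
    then show ?thesis
      using mult_right_mono[OF _ norm_ge_zero[of "char M t"]]
      by (simp only: K_def False if_False norm_mult)
  qed (simp add: K_def)
  have K_meas [measurable]: "K y \<in> borel_measurable borel" for y
    unfolding K_def by measurable
  have K_int: "integrable lborel (K y)" for y
    by (rule Bochner_Integration.integrable_bound[where f="\<lambda>t. \<bar>y - a\<bar> * cmod (char M t)"])
      (use psi K_bound in \<open>auto simp: abs_mult\<close>)
  have "((\<lambda>y. CLINT t|lborel. K y t) has_vector_derivative (CLINT t|lborel. K' x t)) (at x)"
  proof (rule has_vector_derivative_lebesgue_integral[OF K_int integrable_norm[OF psi]])
    show "((\<lambda>y. K y t) has_vector_derivative K' y t) (at y)" for y t
    proof (cases "t = 0")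
      case False
      have "((\<lambda>y. iexp (-(t * y))) has_vector_derivative (-(\<i> * t) * iexp (-(t * y)))) (at y)"
        by (rule has_vector_derivative_eq_rhs,
            rule has_vector_derivative_real_field[where f="\<lambda>z. exp (- (\<i> * t) * z)",
              THEN has_vector_derivative_transform_within[OF _ zero_less_one]])
          (auto intro!: derivative_eq_intros simp: mult_ac)
      then show ?thesis
        using False unfolding K_def K'_def
        by (auto intro!: derivative_eq_intros)
    qed (simp add: K_def K'_def)
    show "cmod (K' y t) \<le> cmod (char M t)" for y t
      using norm_exp_i_times[of "-(t * y)"] by (simp add: K'_def norm_mult)
    show "K' x \<in> borel_measurable lborel"
      unfolding K'_def by measurable
  qed
  then have inv_deriv: "((\<lambda>y. 1 / (2 * pi) * (CLINT t|lborel. K y t)) has_vector_derivative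
      (1 / (2 * pi) * (CLINT t|lborel. K' x t))) (at x)"
    by (rule has_vector_derivative_mult_right)
  have null: "measure M {y} = 0" for y
    unfolding M measure_def using p_meas
    by (subst emeasure_density) auto
  have inv: "complex_of_real (measure M {a<..y}) = 1 / (2 * pi) * (CLINT t|lborel. K y t)" if "a \<le> y" for y
  \<comment> \<open>Levy inversion yields only a limit of truncated integrals; as \<open>K y\<close>
    is absolutely integrable, this limit is the full integral.\<close>
  proof (rule LIMSEQ_unique[OF Levy_Inversion[OF that null null]])
    have "(\<lambda>T. CLINT t|lborel. indicator {- real T..real T} t *\<^sub>R K y t) \<longlonglongrightarrow> (CLINT t|lborel. K y t)"
    proof (rule integral_dominated_convergence[where w="\<lambda>t. norm (K y t)"])
      show "AE t in lborel. (\<lambda>T. indicator {- real T..real T} t *\<^sub>R K y t) \<longlonglongrightarrow> K y t"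
      proof (rule AE_I2, rule tendsto_eventually)
        fix t :: real
        show "\<forall>\<^sub>F T in sequentially. indicator {- real T..real T} t *\<^sub>R K y t = K y t"
          using eventually_ge_at_top[of "nat \<lceil>\<bar>t\<bar>\<rceil>"]
          by eventually_elim (auto simp: indicator_def)
      qed
    qed (use K_int in \<open>auto simp: indicator_def\<close>)
    moreover have "(CLBINT t=real_of_int (- int T)..real T. (iexp (-(t * a)) - iexp (-(t * y))) / (\<i> * t) * char M t) =
        (CLINT t|lborel. indicator {- real T..real T} t *\<^sub>R K y t)" for T :: nat
      unfolding K_def
      by (subst interval_integral_Icc)
        (auto simp: set_lebesgue_integral_def intro!: Bochner_Integration.integral_cong)
    ultimately show "(\<lambda>T. 1 / (2 * pi) * (CLBINT t=real_of_int (- int T)..real T.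
        (iexp (-(t * a)) - iexp (-(t * y))) / (\<i> * t) * char M t))
        \<longlonglongrightarrow> 1 / (2 * pi) * (CLINT t|lborel. K y t)"
      by (simp only:) (rule tendsto_mult_left)
  qed
  have cdf: "measure M {a<..y} = integral {a..y} p" if "a \<le> y" for y
  proof -
    have int: "set_integrable lborel {a..y} p"
      by (rule borel_integrable_atLeastAtMost') (rule continuous_on_subset[OF p(1)], simp)
    have "measure M {a<..y} = measure M {a..y}"
      using null[of a] finite_measure_Union[of "{a}" "{a<..y}"] ivl_disj_un_singleton(5)[OF that]
      by simp
    also have "\<dots> = (LINT t:{a..y}|lborel. p t)"
      unfolding M measure_def set_lebesgue_integral_def using p(2) p_meas
      by (subst emeasure_density, simp_all, subst integral_eq_nn_integral)
        (auto
          intro!: arg_cong[where f=enn2real] nn_integral_cong split: split_indicator)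
    also have "\<dots> = integral {a..y} p"
      using int by (rule set_borel_integral_eq_integral)
    finally show ?thesis .
  qed
  have "((\<lambda>y. integral {a..y} p) has_vector_derivative p x) (at x within {a..x+1})"
    by (rule integral_has_vector_derivative)
      (auto intro: continuous_on_subset[OF p(1)] simp: a_def)
  then have "((\<lambda>y. integral {a..y} p) has_vector_derivative p x) (at x)"
    by (simp add: at_within_Icc_at a_def)
  then have "((\<lambda>y. complex_of_real (integral {a..y} p)) has_vector_derivative of_real (p x)) (at x)"
    by (intro has_vector_derivative_of_real) (simp add: has_real_derivative_iff_has_vector_derivative)
  then have "((\<lambda>y. 1 / (2 * pi) * (CLINT t|lborel. K y t)) has_vector_derivative of_real (p x)) (at x)"
    by (rule has_vector_derivative_transform_within_open[where S="{a<..}"])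
      (use inv cdf in \<open>auto simp: a_def\<close>)
  with inv_deriv have "complex_of_real (p x) = 1 / (2 * pi) * (CLINT t|lborel. K' x t)"
    using vector_derivative_unique_at by blast
  \<comment> \<open>The integrands differ at most at \<open>t = 0\<close>, a null set.\<close>
  also have "(CLINT t|lborel. K' x t) = (CLINT t|lborel. iexp (-(t * x)) * char M t)"
    by (rule integral_cong_AE, simp add: K'_def, simp, use AE_lborel_singleton[of "0::real"] in eventually_elim)
      (auto simp: K'_def)
  finally show ?thesis .
qed

text \<open>The value -1 of the coefficients at \<open>j = 0\<close> accounts for the overall minus
  sign. Truncated subtraction is harmless: \<open>of_nat m\<close> kills \<open>m - 1\<close> at
  \<open>m = 0\<close>, and the product vanishes for \<open>j > m\<close>.\<close>

lemma tail_coeff_expansion: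
  fixes A :: "nat \<Rightarrow> nat \<Rightarrow> 'a::field_char_0"
  assumes rec: "\<And>m r. A m (Suc r) = A m r + of_nat m / x * A (m - 1) r"
  shows "A m r = - (\<Sum>j\<le>r. of_int (tail_coeff r j (int m)) *
    (\<Prod>l<j. of_nat m - of_nat l) * (1 / x ^ j) * A (m - j) 0)"
proof -
  define T where "T j m = (\<Prod>l<j. of_nat m - of_nat l) * (1 / x ^ j) * A (m - j) 0" for j m
  have T_0: "T 0 m = A m 0" for m
    by (simp add: T_def)
  \<comment> \<open>Splitting off the factor \<open>l = 0\<close> turns the falling factorial of
    \<open>m\<close> into \<open>m\<close> times that of \<open>m - 1\<close>.\<close>
  have T_Suc: "T (Suc j) m = of_nat m / x * T j (m - 1)" for j m
    unfolding T_def prod.lessThan_Suc_shift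
    by (cases m) (auto intro!: prod.cong simp: field_simps)
  have "A m r = - (\<Sum>j\<le>r. of_int (tail_coeff r j (int m)) * T j m)" for m
  proof (induction r arbitrary: m)
    case (Suc r)
    have shift: "of_nat m / x * A (m - 1) r = - (\<Sum>j\<le>r. of_int (tail_coeff r j (int m - 1)) * T (Suc j) m)"
    proof (cases m)
      case (Suc n)
      then show ?thesis
        by (simp add: Suc.IH[of n] T_Suc sum_distrib_left ac_simps)
    qed (simp add: T_Suc)
    \<comment> \<open>Adding the zero coefficient at \<open>j = Suc r\<close> lets the sum, once
      \<open>j = 0\<close> is split off, range over the same indices as
      \<open>shift\<close>.\<close>
    have "A m r = - (\<Sum>j\<le>Suc r. of_int (tail_coeff r j (int m)) * T j m)"
      by (simp add: Suc.IH[of m] tail_coeff_eq_0)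
    then have "A m r = A m 0 - (\<Sum>j\<le>r. of_int (tail_coeff r (Suc j) (int m)) * T (Suc j) m)"
      by (simp only: sum.atMost_Suc_shift) (simp add: T_0)
    then show ?case
      by (simp only: rec shift sum.atMost_Suc_shift)
        (simp add: T_0 sum.distrib algebra_simps)
  qed (simp add: T_0)
  then show ?thesis
    by (simp add: T_def mult.assoc)
qed

theorem theorem7p1:
  fixes M :: "real measure" and p :: "real \<Rightarrow> real"
  assumes "real_distribution M"
    and "C_infinity (char M)"
    and "\<And>r m :: nat. integrable lborel (\<lambda>u::real. \<bar>u\<bar> ^ m * norm (nth_deriv r (char M) u))"
    and "C_infinity p"
    and "\<And>x. 0 \<le> p x"
    and "M = density lborel (\<lambda>x. ennreal (p x))"
  shows "\<forall>(r::nat) (m::nat) (x::real). x \<noteq> 0 \<longrightarrow>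
    complex_of_real (nth_deriv m p x) =
      complex_of_real (\<Sum>j = 1..min r m.
        of_int (tail_coeff r j (int m)) * (\<Prod>l<j. real m - real l) * (1 / x ^ j) * nth_deriv (m - j) p x)
      + (- 1) ^ r * ((- \<i>) powi (int m - int r) / complex_of_real (2 * pi * x ^ r))
        * (CLINT u|lborel. exp (- \<i> * complex_of_real u * complex_of_real x)
            * complex_of_real u ^ m * nth_deriv r (char M) u)"
proof (intro allI impI)
  interpret real_distribution M by fact
  let ?E = "\<lambda>u y. exp (- \<i> * complex_of_real u * complex_of_real y)"
  define J where "J m r y u = ?E u y * complex_of_real u ^ m * nth_deriv r (char M) u" for m r y u
  have nth_deriv: "(nth_deriv n f has_vector_derivative nth_deriv (Suc n) f y) (at y)"
    if "C_infinity f" for n y and f :: "real \<Rightarrow> 'b::real_normed_vector"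
    using that by (simp add: C_infinity_def nth_deriv_Suc vector_derivative_works)
  have cont: "continuous_on UNIV (nth_deriv n f)"
    if "C_infinity f" for n and f :: "real \<Rightarrow> 'b::real_normed_vector"
    using that by (auto simp: C_infinity_def intro: continuous_at_imp_continuous_on differentiable_imp_continuous_within)
  have J_cont: "continuous_on UNIV (J m r y)" for m r y
    unfolding J_def by (intro continuous_intros cont assms)
  have J_meas: "J m r y \<in> borel_measurable borel" for m r y
    using J_cont by (rule borel_measurable_continuous_onI)
  \<comment> \<open>The exponential has modulus 1, so the moment hypothesis provides both
    integrability and the dominating functions.\<close>
  have norm_J: "norm (J m r y u) = \<bar>u\<bar> ^ m * norm (nth_deriv r (char M) u)" for m r y u
    by (simp add: J_def norm_mult norm_power)
  have J_int: "integrable lborel (J m r y)" for m r y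
    by (rule Bochner_Integration.integrable_bound[OF assms(3)[of m r]])
      (use J_meas in \<open>auto simp: norm_J\<close>)
  have E_deriv: "((\<lambda>y. ?E u y) has_vector_derivative (- \<i> * u * ?E u y)) (at y)" for u y
    by (rule has_vector_derivative_eq_rhs, rule has_vector_derivative_real_field)
      (auto intro!: derivative_eq_intros)
  have inversion: "complex_of_real (nth_deriv m p y) = (- \<i>) ^ m / (2 * pi) * (CLINT u|lborel. J m 0 y u)" for m y
  proof (induction m arbitrary: y)
    case 0
    have "integrable lborel (char M)"
      using J_int[of 0 0 0] by (simp add: J_def[abs_def])
    then have "complex_of_real (p y) = 1 / (2 * pi) * (CLINT t|lborel. iexp (-(t * y)) * char M t)"
      using cont[OF assms(4), of 0] assms by (intro density_inversion) auto
    then show ?case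
      by (simp add: J_def mult.assoc)
  next
    case (Suc m)
    have "((\<lambda>y. CLINT u|lborel. J m 0 y u) has_vector_derivative (CLINT u|lborel. - \<i> * J (Suc m) 0 y u)) (at y)"
    \<comment> \<open>Differentiating in \<open>y\<close> brings down \<open>- \<i> * u\<close>, so
      the moment of order \<open>Suc m\<close> of the characteristic function dominates, uniformly
      in \<open>y\<close>.\<close>
    proof (rule has_vector_derivative_lebesgue_integral[OF J_int assms(3)[of "Suc m" 0]])
      show "((\<lambda>y. J m 0 y u) has_vector_derivative - \<i> * J (Suc m) 0 y u) (at y)" for y u
        unfolding J_def by (rule has_vector_derivative_eq_rhs, (rule has_vector_derivative_mult_left E_deriv)+) simp
      show "(\<lambda>u. - \<i> * J (Suc m) 0 y u) \<in> borel_measurable lborel"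
        using J_meas[of "Suc m" 0 y] by simp
    qed (simp only: norm_mult norm_J, simp)
    then have "((\<lambda>y. (- \<i>) ^ m / (2 * pi) * (CLINT u|lborel. J m 0 y u)) has_vector_derivative
        (- \<i>) ^ m / (2 * pi) * (- \<i> * (CLINT u|lborel. J (Suc m) 0 y u))) (at y)"
      by (intro has_vector_derivative_mult_right) simp
    then have "((\<lambda>y. complex_of_real (nth_deriv m p y)) has_vector_derivative
        (- \<i>) ^ m / (2 * pi) * (- \<i> * (CLINT u|lborel. J (Suc m) 0 y u))) (at y)"
      by (simp only: Suc)
    moreover have "((\<lambda>y. complex_of_real (nth_deriv m p y)) has_vector_derivative
        of_real (nth_deriv (Suc m) p y)) (at y)"
      by (intro has_vector_derivative_of_real)
        (simp add: has_real_derivative_iff_has_vector_derivative nth_deriv assms)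
    ultimately show ?case
      using vector_derivative_unique_at by fastforce
  qed
  fix r m :: nat and x :: real
  assume x: "x \<noteq> 0"
  define I where "I m r = (CLINT u|lborel. J m r x u)" for m r
  \<comment> \<open>The three terms come from differentiating the exponential, the power and the
    derivative of the characteristic function in \<open>J m r x\<close>.\<close>
  have parts: "- \<i> * x * I m r + of_nat m * I (m - 1) r + I m (Suc r) = 0" for m r
  proof -
    let ?D = "\<lambda>u. - \<i> * x * J m r x u + of_nat m * J (m - 1) r x u + J m (Suc r) x u"
    have "(CLINT u|lborel. ?D u) = 0"
    proof (rule lborel_integral_derivative_eq_0)
      fix u
      have "((\<lambda>u. ?E u x * complex_of_real u ^ m) has_vector_derivative
          (- \<i> * x * ?E u x * u ^ m + of_nat m * (?E u x * u ^ (m - 1)))) (at u)"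
        by (rule has_vector_derivative_eq_rhs,
            rule has_vector_derivative_real_field[where f="\<lambda>z. exp (- \<i> * z * x) * z ^ m"])
          (auto intro!: derivative_eq_intros)
      from has_vector_derivative_mult[OF this nth_deriv[OF assms(2), of r u]]
      show "(J m r x has_vector_derivative ?D u) (at u)"
        unfolding J_def by (rule has_vector_derivative_eq_rhs) (simp add: algebra_simps)
      show "integrable lborel ?D"
        using J_int by simp
    qed (auto intro!: continuous_intros J_cont J_int)
    then show ?thesis
      using J_int by (simp add: I_def)
  qed
  define A where "A m r = (- 1) ^ r * ((- \<i>) powi (int m - int r) / complex_of_real (2 * pi * x ^ r)) * I m r" for m r
  have A_0: "A m 0 = complex_of_real (nth_deriv m p x)" for m
    by (simp add: A_def inversion I_def power_int_def)
  have A_rec: "A m (Suc r) = A m r + of_nat m / complex_of_real x * A (m - 1) r" for m r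
  proof -
    \<comment> \<open>The exponent may be negative, hence \<open>powi\<close>. Lowering it by one
      multiplies by \<open>\<i>\<close>, the inverse of \<open>- \<i>\<close>.\<close>
    define w where "w = (- \<i>) powi (int m - int r)"
    have w1: "(- \<i>) powi (int m - int (Suc r)) = \<i> * w"
      using power_int_diff[of "- \<i>" "int m - int r" 1] by (simp add: w_def algebra_simps)
    \<comment> \<open>The factor \<open>of_nat m\<close> is kept because \<open>int (m - 1)\<close>
      equals \<open>int m - 1\<close> only for positive \<open>m\<close>.\<close>
    have w2: "of_nat m * (- \<i>) powi (int (m - 1) - int r) = of_nat m * (\<i> * w)"
      using w1 by (cases m) (auto simp: algebra_simps)
    have I: "I m (Suc r) = \<i> * x * I m r - of_nat m * I (m - 1) r"
      using parts[of m r] by (simp add: algebra_simps)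
    have "of_nat m / complex_of_real x * A (m - 1) r =
        (- 1) ^ r * (of_nat m * (- \<i>) powi (int (m - 1) - int r)) / (2 * pi * x ^ Suc r) * I (m - 1) r"
      by (simp add: A_def mult_ac)
    also have "\<dots> = (- 1) ^ r * (of_nat m * (\<i> * w)) / (2 * pi * x ^ Suc r) * I (m - 1) r"
      by (simp only: w2)
    finally have prev: "of_nat m / complex_of_real x * A (m - 1) r = \<dots>" .
    show ?thesis
      unfolding prev using x unfolding A_def w1 w_def[symmetric] I by (simp add: field_simps)
  qed
  let ?t = "\<lambda>j. of_int (tail_coeff r j (int m)) * (\<Prod>l<j. real m - real l) * (1 / x ^ j) * nth_deriv (m - j) p x"
  have "A m r = - complex_of_real (\<Sum>j\<le>r. ?t j)"
    by (subst tail_coeff_expansion[of A "complex_of_real x", OF A_rec]) (simp add: A_0)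
  \<comment> \<open>The term \<open>?t 0\<close> is \<open>- nth_deriv m p x\<close>; moving it
    across isolates the derivative sought.\<close>
  also have "(\<Sum>j\<le>r. ?t j) = ?t 0 + (\<Sum>j=1..r. ?t j)"
    by (simp add: atMost_atLeast0 sum.atLeast_Suc_atMost)
  \<comment> \<open>For \<open>m < j\<close> the product contains the factor \<open>l = m\<close>,
    which is 0.\<close>
  also have "(\<Sum>j=1..r. ?t j) = (\<Sum>j=1..min r m. ?t j)"
    by (rule sum.mono_neutral_right) auto
  finally show "complex_of_real (nth_deriv m p x) = complex_of_real (\<Sum>j=1..min r m. ?t j)
      + (- 1) ^ r * ((- \<i>) powi (int m - int r) / complex_of_real (2 * pi * x ^ r))
        * (CLINT u|lborel. ?E u x * complex_of_real u ^ m * nth_deriv r (char M) u)"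
    by (simp add: A_def I_def J_def)
qed

end
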